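(* Let $M$ be an $n$-dimensional space form $M(c)$ of constant sectional curvature $c$, or an $n$-dimensional hypersurface of Euclidean space $E^{n+1}$, with $n\ge 3$. Let $\alpha: I\to M$ be a non-degenerate curve with Frenet frame $\{v_1,\dots,v_n\}$ and harmonic curvatures $\{H_1,\dots,H_{n-2}\}$, and let $D=v_1+H_1v_3+\dots+H_{n-2}v_n$ be its generalized Darboux vector. Then $\alpha$ is an LC helix if and only if $D$ is an LC parallel vector field along $\alpha$.
   Context: Let $\nabla$ be the Levi-Civita connection of $M$ and $\langle\cdot,\cdot\rangle$ its metric; $I\subset\mathbb{R}$ is an open interval. A non-degenerate ($n$-th order regular) curve $\alpha:I\to M$ is a smooth curve with an orthonormal Frenet frame $\{v_1,\dots,v_n\}$ of vector fields along $\alpha$ tangent to $M$, where $v_1$ is the unit tangent, and with nowhere vanishing curvatures $k_1,\dots,k_{n-1}$ (also written $\kappa_i$), such that $\nabla_{v_1}v_1=k_1v_2$, $\nabla_{v_1}v_i=-k_{i-1}v_{i-1}+k_iv_{i+1}$ for $1<i<n$, and $\nabla_{v_1}v_n=-k_{n-1}v_{n-1}$. For a function $f$ along $\alpha$, $v_1[f]$ denotes the derivative of $f$ with respect to arc length. Harmonic curvatures: $H_0=0$, $H_1=\dfrac{k_1}{k_2}$, and $H_i=\dfrac{1}{k_{i+1}}\left(v_1[H_{i-1}]+k_iH_{i-2}\right)$ for $1<i\le n-2$. The generalized Darboux vector of $\alpha$ is $D=v_1+\sum_{i=1}^{n-2}H_iv_{i+2}$. A vector field $X$ along $\alpha$ tangent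 to $M$ is LC parallel (parallel in the sense of Levi-Civita) if $\nabla_{v_1}X=0$. The curve $\alpha$ is an LC helix if there is a unit LC parallel vector field $X$ along $\alpha$ such that $\langle v_1,X\rangle=\cos\varphi$ is constant along $\alpha$; such an $X$ is called an axis of the LC helix. *)

theory Defs
  imports "HOL-Analysis.Analysis"
begin

section \<open>Smooth maps between normed spaces\<close>

text \<open>Only used on open sets, where \<^term>\<open>at x\<close> is the right filter.\<close>

primrec Ck_on :: "nat \<Rightarrow> 'a::real_normed_vector set \<Rightarrow> ('a \<Rightarrow> 'b::real_normed_vector) \<Rightarrow> bool" where
  "Ck_on 0 S f \<longleftrightarrow> continuous_on S f"
| "Ck_on (Suc m) S f \<longleftrightarrow>
     (\<forall>x\<in>S. f differentiable (at x)) \<and> (\<forall>u. Ck_on m S (\<lambda>x. frechet_derivative f (at x) u))"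

definition smooth_on :: "'a::real_normed_vector set \<Rightarrow> ('a \<Rightarrow> 'b::real_normed_vector) \<Rightarrow> bool" where
  "smooth_on S f \<longleftrightarrow> (\<forall>m. Ck_on m S f)"


section \<open>Riemannian manifolds\<close>

text \<open>
  A chart is a pair of its domain and its coordinate map. The metric is given by its coordinate
  matrices: \<open>rm_metric M c x\<close> is the matrix of the metric in the chart \<open>c\<close> at the point with
  coordinates \<open>x\<close>. The dimension is \<open>CARD('n)\<close>.
\<close>

type_synonym ('p, 'n) chart = "'p set \<times> ('p \<Rightarrow> real ^ 'n)"

record ('p, 'n) riem =
  rm_top :: "'p topology"
  rm_atlas :: "('p, 'n) chart set"
  rm_metric :: "('p, 'n) chart \<Rightarrow> real ^ 'n \<Rightarrow> real ^ 'n ^ 'n"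

definition charts_at :: "('p, 'n::finite) riem \<Rightarrow> 'p \<Rightarrow> ('p, 'n) chart set" where
  "charts_at M p = {c \<in> rm_atlas M. p \<in> fst c}"

definition transition :: "('p, 'n::finite) chart \<Rightarrow> ('p, 'n) chart \<Rightarrow> real ^ 'n \<Rightarrow> real ^ 'n" where
  "transition c c' = snd c' \<circ> inv_into (fst c) (snd c)"

definition transition_deriv ::
    "('p, 'n::finite) chart \<Rightarrow> ('p, 'n) chart \<Rightarrow> 'p \<Rightarrow> real ^ 'n \<Rightarrow> real ^ 'n" where
  "transition_deriv c c' p = frechet_derivative (transition c c') (at (snd c p))"

definition smooth_manifold :: "('p, 'n::finite) riem \<Rightarrow> bool" where
  "smooth_manifold M \<longleftrightarrow>
     Hausdorff_space (rm_top M) \<and> second_countable (rm_top M) \<and>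
     (\<Union>c\<in>rm_atlas M. fst c) = topspace (rm_top M) \<and>
     (\<forall>c\<in>rm_atlas M. openin (rm_top M) (fst c) \<and> open (snd c ` fst c) \<and>
        homeomorphic_map (subtopology (rm_top M) (fst c)) (top_of_set (snd c ` fst c)) (snd c)) \<and>
     (\<forall>c\<in>rm_atlas M. \<forall>c'\<in>rm_atlas M. smooth_on (snd c ` (fst c \<inter> fst c')) (transition c c'))"

definition riemannian_manifold :: "('p, 'n::finite) riem \<Rightarrow> bool" where
  "riemannian_manifold M \<longleftrightarrow>
     smooth_manifold M \<and>
     (\<forall>c\<in>rm_atlas M.
        (\<forall>i j. smooth_on (snd c ` fst c) (\<lambda>x. rm_metric M c x $ i $ j)) \<and>
        (\<forall>x\<in>snd c ` fst c. transpose (rm_metric M c x) = rm_metric M c x \<and>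
           (\<forall>u. u \<noteq> 0 \<longrightarrow> u \<bullet> (rm_metric M c x *v u) > 0))) \<and>
     (\<forall>c\<in>rm_atlas M. \<forall>c'\<in>rm_atlas M. \<forall>p\<in>fst c \<inter> fst c'. \<forall>u w.
        u \<bullet> (rm_metric M c (snd c p) *v w) =
        transition_deriv c c' p u \<bullet> (rm_metric M c' (snd c' p) *v transition_deriv c c' p w))"

text \<open>
  A tangent vector at \<open>p\<close> is the family of its coordinate vectors in the charts around \<open>p\<close>, related
  by the differentials of the transition maps; the values at other charts carry no meaning.
\<close>

type_synonym ('p, 'n) tvec = "('p, 'n) chart \<Rightarrow> real ^ 'n"

definition tangent_vector :: "('p, 'n::finite) riem \<Rightarrow> 'p \<Rightarrow> ('p, 'n) tvec \<Rightarrow> bool" where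
  "tangent_vector M p u \<longleftrightarrow>
     (\<forall>c\<in>charts_at M p. \<forall>c'\<in>charts_at M p. u c' = transition_deriv c c' p (u c))"

text \<open>By the transformation rule of the metric, the choice of the chart is immaterial.\<close>

definition tangent_inner ::
    "('p, 'n::finite) riem \<Rightarrow> 'p \<Rightarrow> ('p, 'n) tvec \<Rightarrow> ('p, 'n) tvec \<Rightarrow> real" where
  "tangent_inner M p u w =
     (let c = (SOME c. c \<in> charts_at M p) in u c \<bullet> (rm_metric M c (snd c p) *v w c))"


section \<open>Levi-Civita connection and curvature in coordinates\<close>

definition partial_deriv :: "'n::finite \<Rightarrow> (real ^ 'n \<Rightarrow> real) \<Rightarrow> real ^ 'n \<Rightarrow> real" where
  "partial_deriv i f x = frechet_derivative f (at x) (axis i 1)"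

text \<open>\<open>christoffel M c k i j x\<close> is the symbol with upper index \<open>k\<close> and lower indices \<open>i\<close>, \<open>j\<close>.\<close>

definition christoffel ::
    "('p, 'n::finite) riem \<Rightarrow> ('p, 'n) chart \<Rightarrow> 'n \<Rightarrow> 'n \<Rightarrow> 'n \<Rightarrow> real ^ 'n \<Rightarrow> real" where
  "christoffel M c k i j x =
     1 / 2 * (\<Sum>l\<in>UNIV. matrix_inv (rm_metric M c x) $ k $ l *
       (partial_deriv i (\<lambda>y. rm_metric M c y $ j $ l) x +
        partial_deriv j (\<lambda>y. rm_metric M c y $ i $ l) x -
        partial_deriv l (\<lambda>y. rm_metric M c y $ i $ j) x))"

text \<open>
  \<open>curvature_coeff M c l i j k x\<close> is the \<open>l\<close>-th component of \<open>R(\<partial>\<^sub>i, \<partial>\<^sub>j)\<partial>\<^sub>k\<close>, where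
  \<open>R(X, Y) Z = \<nabla>\<^sub>X \<nabla>\<^sub>Y Z - \<nabla>\<^sub>Y \<nabla>\<^sub>X Z - \<nabla>\<^bsub>[X, Y]\<^esub> Z\<close>.
\<close>

definition curvature_coeff ::
    "('p, 'n::finite) riem \<Rightarrow> ('p, 'n) chart \<Rightarrow> 'n \<Rightarrow> 'n \<Rightarrow> 'n \<Rightarrow> 'n \<Rightarrow> real ^ 'n \<Rightarrow> real" where
  "curvature_coeff M c l i j k x =
     partial_deriv i (christoffel M c l j k) x - partial_deriv j (christoffel M c l i k) x +
     (\<Sum>m\<in>UNIV. christoffel M c l i m x * christoffel M c m j k x -
                christoffel M c l j m x * christoffel M c m i k x)"

definition curvature_op ::
    "('p, 'n::finite) riem \<Rightarrow> ('p, 'n) chart \<Rightarrow> real ^ 'n \<Rightarrow>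
     real ^ 'n \<Rightarrow> real ^ 'n \<Rightarrow> real ^ 'n \<Rightarrow> real ^ 'n" where
  "curvature_op M c x u w z =
     (\<chi> l. \<Sum>i\<in>UNIV. \<Sum>j\<in>UNIV. \<Sum>k\<in>UNIV. curvature_coeff M c l i j k x * u $ i * w $ j * z $ k)"

text \<open>Sectional curvature of the plane spanned by linearly independent \<open>u\<close> and \<open>w\<close>.\<close>

definition sectional_curvature ::
    "('p, 'n::finite) riem \<Rightarrow> ('p, 'n) chart \<Rightarrow> real ^ 'n \<Rightarrow> real ^ 'n \<Rightarrow> real ^ 'n \<Rightarrow> real" where
  "sectional_curvature M c x u w =
     (let g = (\<lambda>a b. a \<bullet> (rm_metric M c x *v b))
      in g (curvature_op M c x u w w) u / (g u u * g w w - (g u w)\<^sup>2))"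

definition constant_sectional_curvature :: "('p, 'n::finite) riem \<Rightarrow> real \<Rightarrow> bool" where
  "constant_sectional_curvature M \<kappa> \<longleftrightarrow>
     (\<forall>c\<in>rm_atlas M. \<forall>x\<in>snd c ` fst c. \<forall>u w.
        u \<noteq> w \<and> independent {u, w} \<longrightarrow> sectional_curvature M c x u w = \<kappa>)"


section \<open>Curves and vector fields along curves\<close>

definition smooth_curve :: "('p, 'n::finite) riem \<Rightarrow> real set \<Rightarrow> (real \<Rightarrow> 'p) \<Rightarrow> bool" where
  "smooth_curve M I \<alpha> \<longleftrightarrow>
     continuous_map (top_of_set I) (rm_top M) \<alpha> \<and>
     (\<forall>c\<in>rm_atlas M. smooth_on {s \<in> I. \<alpha> s \<in> fst c} (snd c \<circ> \<alpha>))"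

definition smooth_vector_field_along ::
    "('p, 'n::finite) riem \<Rightarrow> real set \<Rightarrow> (real \<Rightarrow> 'p) \<Rightarrow> (real \<Rightarrow> ('p, 'n) tvec) \<Rightarrow> bool" where
  "smooth_vector_field_along M I \<alpha> X \<longleftrightarrow>
     (\<forall>s\<in>I. tangent_vector M (\<alpha> s) (X s)) \<and>
     (\<forall>c\<in>rm_atlas M. smooth_on {s \<in> I. \<alpha> s \<in> fst c} (\<lambda>s. X s c))"

definition velocity :: "(real \<Rightarrow> 'p) \<Rightarrow> real \<Rightarrow> ('p, 'n::finite) tvec" where
  "velocity \<alpha> s = (\<lambda>c. vector_derivative (snd c \<circ> \<alpha>) (at s))"

definition speed :: "('p, 'n::finite) riem \<Rightarrow> (real \<Rightarrow> 'p) \<Rightarrow> real \<Rightarrow> real" where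
  "speed M \<alpha> s = sqrt (tangent_inner M (\<alpha> s) (velocity \<alpha> s) (velocity \<alpha> s))"

definition unit_tangent :: "('p, 'n::finite) riem \<Rightarrow> (real \<Rightarrow> 'p) \<Rightarrow> real \<Rightarrow> ('p, 'n) tvec" where
  "unit_tangent M \<alpha> s = (\<lambda>c. (1 / speed M \<alpha> s) *\<^sub>R velocity \<alpha> s c)"

text \<open>The Levi-Civita covariant derivative of \<open>X\<close> along \<open>\<alpha>\<close> with respect to the curve parameter.\<close>

definition covariant_deriv ::
    "('p, 'n::finite) riem \<Rightarrow> (real \<Rightarrow> 'p) \<Rightarrow> (real \<Rightarrow> ('p, 'n) tvec) \<Rightarrow> real \<Rightarrow> ('p, 'n) tvec" where
  "covariant_deriv M \<alpha> X s = (\<lambda>c.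
     vector_derivative (\<lambda>t. X t c) (at s) +
     (\<chi> k. \<Sum>i\<in>UNIV. \<Sum>j\<in>UNIV.
        christoffel M c k i j (snd c (\<alpha> s)) * velocity \<alpha> s c $ i * X s c $ j))"

text \<open>
  The curve need not be parametrized by arc length. The following two operators are
  \<open>\<nabla>\<^bsub>v\<^sub>1\<^esub> X\<close> and \<open>v\<^sub>1[f]\<close> for the unit tangent \<open>v\<^sub>1\<close> of \<open>\<alpha>\<close>.
\<close>

definition nabla_T ::
    "('p, 'n::finite) riem \<Rightarrow> (real \<Rightarrow> 'p) \<Rightarrow> (real \<Rightarrow> ('p, 'n) tvec) \<Rightarrow> real \<Rightarrow> ('p, 'n) tvec" where
  "nabla_T M \<alpha> X s = (\<lambda>c. (1 / speed M \<alpha> s) *\<^sub>R covariant_deriv M \<alpha> X s c)"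

definition arc_deriv ::
    "('p, 'n::finite) riem \<Rightarrow> (real \<Rightarrow> 'p) \<Rightarrow> (real \<Rightarrow> real) \<Rightarrow> real \<Rightarrow> real" where
  "arc_deriv M \<alpha> f s = deriv f s / speed M \<alpha> s"


section \<open>Space forms and hypersurfaces\<close>

definition geodesic :: "('p, 'n::finite) riem \<Rightarrow> real set \<Rightarrow> (real \<Rightarrow> 'p) \<Rightarrow> bool" where
  "geodesic M I \<gamma> \<longleftrightarrow>
     smooth_curve M I \<gamma> \<and>
     (\<forall>s\<in>I. \<forall>c\<in>charts_at M (\<gamma> s). covariant_deriv M \<gamma> (velocity \<gamma>) s c = 0)"

definition geodesically_complete :: "('p, 'n::finite) riem \<Rightarrow> bool" where
  "geodesically_complete M \<longleftrightarrow>
     (\<forall>p\<in>topspace (rm_top M). \<forall>u. tangent_vector M p u \<longrightarrow>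
        (\<exists>\<gamma>. geodesic M UNIV \<gamma> \<and> \<gamma> 0 = p \<and> (\<forall>c\<in>charts_at M p. velocity \<gamma> 0 c = u c)))"

definition space_form :: "('p, 'n::finite) riem \<Rightarrow> real \<Rightarrow> bool" where
  "space_form M \<kappa> \<longleftrightarrow>
     riemannian_manifold M \<and> connected_space (rm_top M) \<and> geodesically_complete M \<and>
     constant_sectional_curvature M \<kappa>"

text \<open>
  A hypersurface is an isometrically immersed manifold of codimension one, i.e. its metric is the
  first fundamental form. A hypersurface that is a subset of the Euclidean space is the case where
  \<open>F\<close> is the inclusion.
\<close>

definition euclidean_hypersurface ::
    "('p, 'n::finite) riem \<Rightarrow> ('p \<Rightarrow> 'e::euclidean_space) \<Rightarrow> bool" where
  "euclidean_hypersurface M F \<longleftrightarrow>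
     riemannian_manifold M \<and> DIM('e) = CARD('n) + 1 \<and>
     (\<forall>c\<in>rm_atlas M. let f = F \<circ> inv_into (fst c) (snd c) in
        smooth_on (snd c ` fst c) f \<and>
        (\<forall>x\<in>snd c ` fst c. \<forall>i j.
           rm_metric M c x $ i $ j =
           frechet_derivative f (at x) (axis i 1) \<bullet> frechet_derivative f (at x) (axis j 1)))"


section \<open>Frenet frames, harmonic curvatures and LC helices\<close>

text \<open>The frame \<open>v\<close> is indexed by \<open>{1..n}\<close> and the curvatures \<open>k\<close> by \<open>{1..n - 1}\<close>.\<close>

definition nondegenerate_curve ::
    "('p, 'n::finite) riem \<Rightarrow> real set \<Rightarrow> (real \<Rightarrow> 'p) \<Rightarrow>
     (nat \<Rightarrow> real \<Rightarrow> ('p, 'n) tvec) \<Rightarrow> (nat \<Rightarrow> real \<Rightarrow> real) \<Rightarrow> bool" where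
  "nondegenerate_curve M I \<alpha> v k \<longleftrightarrow>
     (let n = CARD('n) in
       smooth_curve M I \<alpha> \<and>
       (\<forall>s\<in>I. speed M \<alpha> s > 0) \<and>
       (\<forall>i\<in>{1..n}. smooth_vector_field_along M I \<alpha> (v i)) \<and>
       (\<forall>s\<in>I. \<forall>i\<in>{1..n}. \<forall>j\<in>{1..n}.
          tangent_inner M (\<alpha> s) (v i s) (v j s) = (if i = j then 1 else 0)) \<and>
       (\<forall>i\<in>{1..n - 1}. \<forall>s\<in>I. k i s \<noteq> 0) \<and>
       (\<forall>s\<in>I. \<forall>c\<in>charts_at M (\<alpha> s).
          v 1 s c = unit_tangent M \<alpha> s c \<and>
          nabla_T M \<alpha> (v 1) s c = k 1 s *\<^sub>R v 2 s c \<and>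
          (\<forall>i. 1 < i \<and> i < n \<longrightarrow>
             nabla_T M \<alpha> (v i) s c = - k (i - 1) s *\<^sub>R v (i - 1) s c + k i s *\<^sub>R v (i + 1) s c) \<and>
          nabla_T M \<alpha> (v n) s c = - k (n - 1) s *\<^sub>R v (n - 1) s c))"

fun harmonic_curvature ::
    "('p, 'n::finite) riem \<Rightarrow> (real \<Rightarrow> 'p) \<Rightarrow> (nat \<Rightarrow> real \<Rightarrow> real) \<Rightarrow> nat \<Rightarrow> real \<Rightarrow> real" where
  "harmonic_curvature M \<alpha> k 0 = (\<lambda>s. 0)"
| "harmonic_curvature M \<alpha> k (Suc 0) = (\<lambda>s. k 1 s / k 2 s)"
| "harmonic_curvature M \<alpha> k (Suc (Suc i)) = (\<lambda>s.
     1 / k (i + 3) s *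
     (arc_deriv M \<alpha> (harmonic_curvature M \<alpha> k (Suc i)) s +
      k (i + 2) s * harmonic_curvature M \<alpha> k i s))"

definition darboux ::
    "('p, 'n::finite) riem \<Rightarrow> (real \<Rightarrow> 'p) \<Rightarrow> (nat \<Rightarrow> real \<Rightarrow> ('p, 'n) tvec) \<Rightarrow>
     (nat \<Rightarrow> real \<Rightarrow> real) \<Rightarrow> real \<Rightarrow> ('p, 'n) tvec" where
  "darboux M \<alpha> v k s = (\<lambda>c.
     v 1 s c + (\<Sum>i = 1..CARD('n) - 2. harmonic_curvature M \<alpha> k i s *\<^sub>R v (i + 2) s c))"

definition LC_parallel ::
    "('p, 'n::finite) riem \<Rightarrow> real set \<Rightarrow> (real \<Rightarrow> 'p) \<Rightarrow> (real \<Rightarrow> ('p, 'n) tvec) \<Rightarrow> bool" where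
  "LC_parallel M I \<alpha> X \<longleftrightarrow>
     smooth_vector_field_along M I \<alpha> X \<and>
     (\<forall>s\<in>I. \<forall>c\<in>charts_at M (\<alpha> s). nabla_T M \<alpha> X s c = 0)"

definition LC_helix :: "('p, 'n::finite) riem \<Rightarrow> real set \<Rightarrow> (real \<Rightarrow> 'p) \<Rightarrow> bool" where
  "LC_helix M I \<alpha> \<longleftrightarrow>
     (\<exists>X \<phi>. LC_parallel M I \<alpha> X \<and>
        (\<forall>s\<in>I. tangent_inner M (\<alpha> s) (X s) (X s) = 1) \<and>
        (\<forall>s\<in>I. tangent_inner M (\<alpha> s) (unit_tangent M \<alpha> s) (X s) = cos \<phi>))"

end

theory Submission
  imports Defs
begin

text \<open>
  Let \<open>X\<close> be a parallel field along the curve and \<open>x\<^sub>j = \<langle>X, v\<^sub>j\<rangle>\<close>. As the Levi-Civita connection is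
  metric, \<open>v\<^sub>1[x\<^sub>j] = \<langle>X, \<nabla> v\<^sub>j\<rangle>\<close>, so the Frenet equations turn parallelism of \<open>X\<close> into the
  system \<open>v\<^sub>1[x\<^sub>j] = - k\<^bsub>j-1\<^esub> x\<^bsub>j-1\<^esub> + k\<^sub>j x\<^bsub>j+1\<^esub>\<close>. Since no curvature vanishes, the system can be
  solved for \<open>x\<^bsub>j+1\<^esub>\<close>: all coordinates are determined by \<open>x\<^sub>1\<close>. If \<open>x\<^sub>1 = a\<close> is constant, then
  \<open>x\<^sub>2 = 0\<close>, and the recursion for \<open>x\<^bsub>i+2\<^esub>\<close> is that of the harmonic curvatures multiplied by \<open>a\<close>
  (\<open>parallel_coordinates\<close>). Hence \<open>X = a D\<close> (\<open>parallel_eq_darboux\<close>).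

  For the axis \<open>X\<close> of a helix this gives \<open>X = cos \<phi> D\<close>, and \<open>cos \<phi>\<close> cannot vanish because \<open>X\<close> is a
  unit field; so \<open>D\<close> is a constant multiple of \<open>X\<close> and is parallel. Conversely, if \<open>D\<close> is parallel,
  then \<open>\<langle>D, D\<rangle>\<close> has derivative zero and is constant on the interval, and it is at least 1 because
  \<open>D\<close> has the component 1 along \<open>v\<^sub>1\<close>. So \<open>D\<close> divided by its norm is a unit parallel field, whose
  inner product with \<open>v\<^sub>1\<close> is the constant \<open>1 / |D|\<close> in the interval from 0 to 1, i.e. a cosine.

  The product rule for the inner product of two fields along the curve
  (\<open>tangent_inner_has_derivative\<close>) is derived from the coordinate formula of the Christoffel symbols,
  which says precisely that the metric is covariantly constant.
\<close>

section \<open>Smooth maps\<close>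

text \<open>
  The equation between \<open>f\<close> and \<open>g\<close> is known only on \<open>S\<close>. As \<open>S\<close> is open, it passes to the
  derivatives on \<open>S\<close>, and the induction on the order can continue.
\<close>

lemma Ck_on_scaleR_cong:
  assumes "open S" "Ck_on m S f" "\<And>x. x \<in> S \<Longrightarrow> g x = r *\<^sub>R f x"
  shows "Ck_on m S g"
  using assms(2,3)
proof (induction m arbitrary: f g)
  case 0
  then have "continuous_on S (\<lambda>x. r *\<^sub>R f x)"
    by (auto intro: continuous_intros)
  then show ?case
    using 0 by (auto cong: continuous_on_cong)
next
  case (Suc m)
  have der: "(g has_derivative (\<lambda>u. r *\<^sub>R frechet_derivative f (at x) u)) (at x)" if "x \<in> S" for x
  proof (rule has_derivative_transform_within_open)
    have "(f has_derivative frechet_derivative f (at x)) (at x)"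
      using Suc.prems(1) that by (simp add: frechet_derivative_works)
    then show "((\<lambda>x. r *\<^sub>R f x) has_derivative (\<lambda>u. r *\<^sub>R frechet_derivative f (at x) u)) (at x)"
      by (rule has_derivative_scaleR_right)
  qed (use assms(1) that Suc.prems(2) in auto)
  have "Ck_on m S (\<lambda>x. frechet_derivative g (at x) u)" for u
  proof (rule Suc.IH)
    show "Ck_on m S (\<lambda>x. frechet_derivative f (at x) u)"
      using Suc.prems(1) by simp
    show "frechet_derivative g (at x) u = r *\<^sub>R frechet_derivative f (at x) u" if "x \<in> S" for x
      using frechet_derivative_at[OF der[OF that]] by metis
  qed
  then show ?case
    using der by (auto simp: differentiable_def)
qed

lemma smooth_on_scaleR_cong:
  assumes "open S" "smooth_on S f" "\<And>x. x \<in> S \<Longrightarrow> g x = r *\<^sub>R f x"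
  shows "smooth_on S g"
  using assms Ck_on_scaleR_cong unfolding smooth_on_def by blast

lemma smooth_on_differentiable:
  assumes "smooth_on S f" "x \<in> S"
  shows "f differentiable (at x)"
  using assms unfolding smooth_on_def by (metis Ck_on.simps(2))


section \<open>The inner product of tangent vectors in charts\<close>

lemma smooth_manifold_charts_at_nonempty:
  assumes "smooth_manifold M" "p \<in> topspace (rm_top M)"
  shows "\<exists>c. c \<in> charts_at M p"
  using assms unfolding smooth_manifold_def charts_at_def by blast

lemma transition_deriv_linear:
  assumes "smooth_manifold M" "c \<in> charts_at M p" "c' \<in> charts_at M p"
  shows "linear (transition_deriv c c' p)"
proof -
  have "transition c c' differentiable (at (snd c p))"
    using assms unfolding smooth_manifold_def charts_at_def
    by (intro smooth_on_differentiable[where S = "snd c ` (fst c \<inter> fst c')"]) auto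
  then show ?thesis
    unfolding transition_deriv_def by (rule linear_frechet_derivative)
qed

lemma tangent_vector_scaleR_cong:
  assumes "smooth_manifold M" "tangent_vector M p u"
    and "\<And>c. c \<in> charts_at M p \<Longrightarrow> w c = r *\<^sub>R u c"
  shows "tangent_vector M p w"
  unfolding tangent_vector_def
proof (intro ballI)
  fix c c' assume c: "c \<in> charts_at M p" "c' \<in> charts_at M p"
  have "u c' = transition_deriv c c' p (u c)"
    using assms(2) c unfolding tangent_vector_def by blast
  then show "w c' = transition_deriv c c' p (w c)"
    using assms(3) c linear_cmul[OF transition_deriv_linear[OF assms(1) c]] by simp
qed

text \<open>
  The transformation rules of the metric and of tangent vectors cancel, so the chart selected in the
  definition of the inner product may be replaced by any chart that suits the computation.
\<close>

lemma tangent_inner_chart: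
  assumes "riemannian_manifold M" "c \<in> charts_at M p" "tangent_vector M p u" "tangent_vector M p w"
  shows "tangent_inner M p u w = u c \<bullet> (rm_metric M c (snd c p) *v w c)"
proof -
  define d where "d = (SOME c. c \<in> charts_at M p)"
  have d: "d \<in> charts_at M p"
    unfolding d_def using assms(2) by (rule someI)
  have "u c = transition_deriv d c p (u d)" "w c = transition_deriv d c p (w d)"
    using assms d unfolding tangent_vector_def by blast+
  then have "u d \<bullet> (rm_metric M d (snd d p) *v w d) = u c \<bullet> (rm_metric M c (snd c p) *v w c)"
    using assms(1,2) d unfolding riemannian_manifold_def charts_at_def
    by (smt (verit) IntI mem_Collect_eq)
  then show ?thesis
    by (simp add: tangent_inner_def d_def[symmetric])
qed

lemma tangent_inner_cong:
  assumes "\<exists>c. c \<in> charts_at M p"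
    and "\<And>c. c \<in> charts_at M p \<Longrightarrow> u c = u' c" "\<And>c. c \<in> charts_at M p \<Longrightarrow> w c = w' c"
  shows "tangent_inner M p u w = tangent_inner M p u' w'"
  using assms someI_ex[OF assms(1)] by (simp add: tangent_inner_def Let_def)

lemma tangent_inner_add_right:
  "tangent_inner M p u (\<lambda>c. w c + w' c) = tangent_inner M p u w + tangent_inner M p u w'"
  by (simp add: tangent_inner_def Let_def matrix_vector_right_distrib inner_add_right)

lemma tangent_inner_scaleR_right:
  "tangent_inner M p u (\<lambda>c. r *\<^sub>R w c) = r * tangent_inner M p u w"
  by (simp add: tangent_inner_def Let_def matrix_vector_mult_scaleR)

lemma tangent_inner_scaleR_left:
  "tangent_inner M p (\<lambda>c. r *\<^sub>R u c) w = r * tangent_inner M p u w"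
  by (simp add: tangent_inner_def Let_def)

lemma tangent_inner_zero [simp]:
  "tangent_inner M p (\<lambda>c. 0) w = 0" "tangent_inner M p u (\<lambda>c. 0) = 0"
  by (simp_all add: tangent_inner_def Let_def)

lemma tangent_inner_add_left:
  "tangent_inner M p (\<lambda>c. u c + u' c) w = tangent_inner M p u w + tangent_inner M p u' w"
  by (simp add: tangent_inner_def Let_def inner_add_left)

lemma tangent_inner_sum_left:
  "tangent_inner M p (\<lambda>c. \<Sum>i\<in>A. f i c) w = (\<Sum>i\<in>A. tangent_inner M p (f i) w)"
  by (simp add: tangent_inner_def Let_def inner_sum_left)

lemma metric_symmetric_positive:
  assumes "riemannian_manifold M" "c \<in> rm_atlas M" "x \<in> snd c ` fst c"
  shows "transpose (rm_metric M c x) = rm_metric M c x"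
    and "u \<noteq> 0 \<Longrightarrow> u \<bullet> (rm_metric M c x *v u) > 0"
  using assms unfolding riemannian_manifold_def by blast+

lemma metric_differentiable:
  assumes "riemannian_manifold M" "c \<in> rm_atlas M" "x \<in> snd c ` fst c"
  shows "(\<lambda>y. rm_metric M c y $ i $ j) differentiable (at x)"
proof (rule smooth_on_differentiable[OF _ assms(3)])
  show "smooth_on (snd c ` fst c) (\<lambda>y. rm_metric M c y $ i $ j)"
    using assms(1,2) unfolding riemannian_manifold_def by blast
qed

lemma charts_at_metric:
  assumes "riemannian_manifold M" "c \<in> charts_at M p"
  shows "transpose (rm_metric M c (snd c p)) = rm_metric M c (snd c p)"
    and "u \<noteq> 0 \<Longrightarrow> u \<bullet> (rm_metric M c (snd c p) *v u) > 0"
  using assms metric_symmetric_positive[OF assms(1)] unfolding charts_at_def by blast+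

lemma tangent_inner_commute:
  assumes "riemannian_manifold M" "\<exists>c. c \<in> charts_at M p"
  shows "tangent_inner M p u w = tangent_inner M p w u"
proof -
  have "x \<bullet> (G *v y) = y \<bullet> (G *v x)" if "transpose G = G" for G :: "real^'b^'b" and x y
    using that by (metis dot_lmul_matrix inner_commute matrix_vector_mul_lid transpose_matrix_vector)
  then show ?thesis
    using charts_at_metric(1)[OF assms(1) someI_ex[OF assms(2)]]
    by (simp add: tangent_inner_def Let_def)
qed

lemma tangent_inner_nonneg:
  assumes "riemannian_manifold M" "\<exists>c. c \<in> charts_at M p"
  shows "tangent_inner M p u u \<ge> 0"
  using charts_at_metric(2)[OF assms(1) someI_ex[OF assms(2)]]
  by (cases "u (SOME c. c \<in> charts_at M p) = 0")
     (auto simp: tangent_inner_def Let_def intro: less_imp_le)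

text \<open>
  Pairing a linear combination of the \<open>e i\<close> with \<open>e j\<close> returns its \<open>j\<close>-th coefficient. This makes
  the \<open>e i\<close> independent, hence by counting a basis, and it identifies the coefficients of \<open>x\<close>.
\<close>

lemma orthonormal_expansion:
  fixes G :: "real^'n^'n" and e :: "nat \<Rightarrow> real^'n"
  assumes "\<And>i j. i \<in> {1..CARD('n)} \<Longrightarrow> j \<in> {1..CARD('n)} \<Longrightarrow>
      e i \<bullet> (G *v e j) = (if i = j then 1 else 0)"
  shows "x = (\<Sum>i = 1..CARD('n). (x \<bullet> (G *v e i)) *\<^sub>R e i)"
proof -
  let ?N = "{1..CARD('n)}"
  have coeff: "(\<Sum>i\<in>?N. a i *\<^sub>R e i) \<bullet> (G *v e j) = a j" if "j \<in> ?N" for a j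
  proof -
    have "(\<Sum>i\<in>?N. a i *\<^sub>R e i) \<bullet> (G *v e j) = (\<Sum>i\<in>?N. if i = j then a i else 0)"
      unfolding inner_sum_left using assms that by (intro sum.cong) auto
    then show ?thesis using that by simp
  qed
  have inj: "inj_on e ?N"
    by (rule inj_onI) (metis assms zero_neq_one)
  have ind: "independent (e ` ?N)"
  proof (rule independent_if_scalars_zero)
    fix f x assume f: "(\<Sum>x\<in>e ` ?N. f x *\<^sub>R x) = 0" and "x \<in> e ` ?N"
    then obtain j where j: "j \<in> ?N" "x = e j" by blast
    have "(\<Sum>i\<in>?N. f (e i) *\<^sub>R e i) = 0"
      using f unfolding sum.reindex[OF inj] o_def .
    then show "f x = 0"
      using coeff[OF j(1), of "\<lambda>i. f (e i)"] j(2) by simp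
  qed simp
  have "dim (UNIV :: (real^'n) set) \<le> card (e ` ?N)"
    unfolding card_image[OF inj] by simp
  then have "x \<in> span (e ` ?N)"
    using card_ge_dim_independent[OF subset_UNIV ind] by blast
  then obtain a where a: "x = (\<Sum>y\<in>e ` ?N. a y *\<^sub>R y)"
    by (auto simp: span_finite)
  then have x: "x = (\<Sum>i\<in>?N. a (e i) *\<^sub>R e i)"
    unfolding sum.reindex[OF inj] o_def .
  have "x \<bullet> (G *v e i) = a (e i)" if "i \<in> ?N" for i
    unfolding x using coeff[OF that] .
  then have "(\<Sum>i\<in>?N. (x \<bullet> (G *v e i)) *\<^sub>R e i) = (\<Sum>i\<in>?N. a (e i) *\<^sub>R e i)"
    by (intro sum.cong refl) simp
  with x show ?thesis by (rule trans[OF _ sym])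
qed


section \<open>Metric compatibility of the Levi-Civita connection\<close>

text \<open>
  Christoffel symbols of the first kind: the metric is invertible, being positive definite, and
  cancels the inverse matrix in the definition of the symbols.
\<close>

lemma christoffel_lower_index:
  assumes "riemannian_manifold M" "c \<in> rm_atlas M" "x \<in> snd c ` fst c"
  shows "(\<Sum>k\<in>UNIV. rm_metric M c x $ p $ k * christoffel M c k i j x) =
     1 / 2 * (partial_deriv i (\<lambda>y. rm_metric M c y $ j $ p) x +
        partial_deriv j (\<lambda>y. rm_metric M c y $ i $ p) x -
        partial_deriv p (\<lambda>y. rm_metric M c y $ i $ j) x)"
proof -
  let ?G = "rm_metric M c x"
  define d where "d l = partial_deriv i (\<lambda>y. rm_metric M c y $ j $ l) x +
        partial_deriv j (\<lambda>y. rm_metric M c y $ i $ l) x -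
        partial_deriv l (\<lambda>y. rm_metric M c y $ i $ j) x" for l
  have "u = 0" if "?G *v u = 0" for u
    using metric_symmetric_positive(2)[OF assms, of u] that by (metis inner_zero_right less_irrefl)
  then have "invertible ?G"
    by (metis invertible_left_inverse matrix_left_invertible_ker)
  then have inv: "?G ** matrix_inv ?G = mat 1"
    unfolding invertible_def matrix_inv_def by (rule someI2_ex) simp
  have "(\<Sum>k\<in>UNIV. ?G $ p $ k * christoffel M c k i j x) =
      1 / 2 * (\<Sum>k\<in>UNIV. \<Sum>l\<in>UNIV. ?G $ p $ k * matrix_inv ?G $ k $ l * d l)"
    by (simp add: christoffel_def d_def sum_distrib_left algebra_simps)
  also have "(\<Sum>k\<in>UNIV. \<Sum>l\<in>UNIV. ?G $ p $ k * matrix_inv ?G $ k $ l * d l) =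
      (\<Sum>l\<in>UNIV. (?G ** matrix_inv ?G) $ p $ l * d l)"
    by (subst sum.swap) (simp add: matrix_matrix_mult_def sum_distrib_right)
  also have "\<dots> = d p"
    by (simp add: inv mat_def if_distrib[of "\<lambda>z. z * _"] cong: if_cong)
  finally show ?thesis
    by (simp add: d_def)
qed

lemma open_chart_image:
  assumes "riemannian_manifold M" "c \<in> rm_atlas M"
  shows "open (snd c ` fst c)"
  using assms unfolding riemannian_manifold_def smooth_manifold_def by auto

text \<open>
  This is \<open>\<nabla> g = 0\<close> in coordinates. In the sum of the two symbols of the first kind, all partial
  derivatives but one cancel by the symmetry of the metric.
\<close>

lemma metric_partial_deriv:
  assumes "riemannian_manifold M" "c \<in> rm_atlas M" "x \<in> snd c ` fst c"
  shows "partial_deriv i (\<lambda>y. rm_metric M c y $ j $ p) x =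
     (\<Sum>k\<in>UNIV. rm_metric M c x $ p $ k * christoffel M c k i j x) +
     (\<Sum>k\<in>UNIV. rm_metric M c x $ j $ k * christoffel M c k i p x)"
proof -
  have sym: "partial_deriv a (\<lambda>y. rm_metric M c y $ b $ d) x =
      partial_deriv a (\<lambda>y. rm_metric M c y $ d $ b) x" for a b d
  proof -
    have eq: "rm_metric M c y $ b $ d = rm_metric M c y $ d $ b" if "y \<in> snd c ` fst c" for y
    proof -
      have "transpose (rm_metric M c y) = rm_metric M c y"
        using assms(1,2) that by (rule metric_symmetric_positive)
      then have "rm_metric M c y $ d $ b = transpose (rm_metric M c y) $ d $ b"
        by simp
      then show ?thesis by (simp add: transpose_def)
    qed
    have "(\<lambda>y. rm_metric M c y $ b $ d) differentiable (at x)"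
      using assms by (rule metric_differentiable)
    then have "((\<lambda>y. rm_metric M c y $ b $ d) has_derivative
        frechet_derivative (\<lambda>y. rm_metric M c y $ b $ d) (at x)) (at x)"
      by (simp add: frechet_derivative_works)
    then have "((\<lambda>y. rm_metric M c y $ d $ b) has_derivative
        frechet_derivative (\<lambda>y. rm_metric M c y $ b $ d) (at x)) (at x)"
      by (rule has_derivative_transform_within_open[OF _ open_chart_image[OF assms(1,2)] assms(3) eq])
    then show ?thesis
      unfolding partial_deriv_def by (metis frechet_derivative_at)
  qed
  show ?thesis
    unfolding christoffel_lower_index[OF assms]
    using sym[of i p j] sym[of p i j] sym[of j i p] by (simp add: field_simps)
qed

lemma smooth_curve_in_topspace:
  assumes "smooth_curve M I \<alpha>" "s \<in> I"
  shows "\<alpha> s \<in> topspace (rm_top M)"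
  using assms unfolding smooth_curve_def continuous_map_def by auto

lemma open_curve_in_chart:
  assumes "smooth_manifold M" "smooth_curve M I \<alpha>" "open I" "c \<in> rm_atlas M"
  shows "open {s \<in> I. \<alpha> s \<in> fst c}"
proof -
  have "openin (rm_top M) (fst c)"
    using assms unfolding smooth_manifold_def by auto
  then have "openin (top_of_set I) {s \<in> topspace (top_of_set I). \<alpha> s \<in> fst c}"
    using assms(2) unfolding smooth_curve_def by (blast intro: openin_continuous_map_preimage)
  then show ?thesis
    using assms(3) by (simp add: openin_open_eq)
qed

lemma bilinear_coordinates:
  fixes G :: "real^'n^'n"
  shows "u \<bullet> (G *v w) = (\<Sum>j\<in>UNIV. \<Sum>p\<in>UNIV. u $ j * (G $ j $ p * w $ p))"
  by (simp add: inner_vec_def matrix_vector_mult_def sum_distrib_left)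

text \<open>
  Metric compatibility for coordinate fields with constant components \<open>u\<close> and \<open>w\<close>: their covariant
  derivatives in direction \<open>a\<close> consist of the Christoffel terms alone, and the right-hand side is
  the derivative of the metric coefficients in direction \<open>a\<close>.
\<close>

lemma christoffel_metric_compatible:
  fixes M :: "('p, 'n::finite) riem" and a u w :: "real^'n"
  assumes "riemannian_manifold M" "c \<in> rm_atlas M" "x \<in> snd c ` fst c"
  defines "\<Gamma> z \<equiv> (\<chi> k. \<Sum>i\<in>UNIV. \<Sum>j\<in>UNIV. christoffel M c k i j x * a $ i * z $ j)"
  shows "\<Gamma> u \<bullet> (rm_metric M c x *v w) + u \<bullet> (rm_metric M c x *v \<Gamma> w) =
    (\<Sum>j\<in>UNIV. \<Sum>p\<in>UNIV. u $ j *
       ((\<Sum>i\<in>UNIV. a $ i * partial_deriv i (\<lambda>y. rm_metric M c y $ j $ p) x) * w $ p))"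
proof -
  let ?G = "rm_metric M c x"
  have right: "y \<bullet> (?G *v \<Gamma> z) = (\<Sum>j\<in>UNIV. \<Sum>p\<in>UNIV. \<Sum>i\<in>UNIV.
      y $ j * a $ i * z $ p * (\<Sum>k\<in>UNIV. ?G $ j $ k * christoffel M c k i p x))" for y z
  proof -
    have "y \<bullet> (?G *v \<Gamma> z) = (\<Sum>j\<in>UNIV. \<Sum>k\<in>UNIV. \<Sum>i\<in>UNIV. \<Sum>p\<in>UNIV.
        y $ j * a $ i * z $ p * (?G $ j $ k * christoffel M c k i p x))"
      unfolding bilinear_coordinates \<Gamma>_def by (simp add: sum_distrib_left mult_ac)
    also have "\<dots> = (\<Sum>j\<in>UNIV. \<Sum>i\<in>UNIV. \<Sum>k\<in>UNIV. \<Sum>p\<in>UNIV.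
        y $ j * a $ i * z $ p * (?G $ j $ k * christoffel M c k i p x))"
      by (intro sum.cong refl sum.swap)
    also have "\<dots> = (\<Sum>j\<in>UNIV. \<Sum>i\<in>UNIV. \<Sum>p\<in>UNIV. \<Sum>k\<in>UNIV.
        y $ j * a $ i * z $ p * (?G $ j $ k * christoffel M c k i p x))"
      by (intro sum.cong refl sum.swap)
    also have "\<dots> = (\<Sum>j\<in>UNIV. \<Sum>p\<in>UNIV. \<Sum>i\<in>UNIV. \<Sum>k\<in>UNIV.
        y $ j * a $ i * z $ p * (?G $ j $ k * christoffel M c k i p x))"
      by (intro sum.cong refl sum.swap)
    finally show ?thesis by (simp add: sum_distrib_left)
  qed
  have "transpose ?G = ?G"
    using assms(1-3) by (rule metric_symmetric_positive)
  then have "\<Gamma> u \<bullet> (?G *v w) = w \<bullet> (?G *v \<Gamma> u)"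
    by (metis dot_lmul_matrix inner_commute transpose_matrix_vector)
  also have "\<dots> = (\<Sum>p\<in>UNIV. \<Sum>j\<in>UNIV. \<Sum>i\<in>UNIV.
      w $ p * a $ i * u $ j * (\<Sum>k\<in>UNIV. ?G $ p $ k * christoffel M c k i j x))"
    by (rule right)
  also have "\<dots> = (\<Sum>j\<in>UNIV. \<Sum>p\<in>UNIV. \<Sum>i\<in>UNIV.
      w $ p * a $ i * u $ j * (\<Sum>k\<in>UNIV. ?G $ p $ k * christoffel M c k i j x))"
    by (rule sum.swap)
  finally have left: "\<Gamma> u \<bullet> (?G *v w) = \<dots>" .
  have "u $ j * ((\<Sum>i\<in>UNIV. a $ i * partial_deriv i (\<lambda>y. rm_metric M c y $ j $ p) x) * w $ p) =
      (\<Sum>i\<in>UNIV. w $ p * a $ i * u $ j * (\<Sum>k\<in>UNIV. ?G $ p $ k * christoffel M c k i j x) +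
        u $ j * a $ i * w $ p * (\<Sum>k\<in>UNIV. ?G $ j $ k * christoffel M c k i p x))" for j p
    unfolding sum_distrib_left sum_distrib_right metric_partial_deriv[OF assms(1-3)]
    by (intro sum.cong refl) (simp add: algebra_simps sum_distrib_left)
  then show ?thesis
    unfolding left right by (simp add: sum.distrib)
qed

text \<open>
  The product rule \<open>\<langle>X, Y\<rangle>' = \<langle>\<nabla> X, Y\<rangle> + \<langle>X, \<nabla> Y\<rangle>\<close>. The derivative at \<open>s\<close> is computed in the
  very chart that the inner product at \<open>s\<close> selects. Nearby points of the curve lie in its domain,
  and the inner product of tangent vectors there has the same value in this chart, so that only one
  coordinate system is involved.
\<close>

lemma tangent_inner_has_derivative:
  fixes M :: "('p, 'n::finite) riem"
  assumes M: "riemannian_manifold M" and I: "open I" and \<alpha>: "smooth_curve M I \<alpha>"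
    and X: "smooth_vector_field_along M I \<alpha> X" and Y: "smooth_vector_field_along M I \<alpha> Y"
    and s: "s \<in> I"
  shows "((\<lambda>t. tangent_inner M (\<alpha> t) (X t) (Y t)) has_real_derivative
     (tangent_inner M (\<alpha> s) (covariant_deriv M \<alpha> X s) (Y s) +
      tangent_inner M (\<alpha> s) (X s) (covariant_deriv M \<alpha> Y s))) (at s)"
proof -
  have sm: "smooth_manifold M"
    using M by (simp add: riemannian_manifold_def)
  define c where "c = (SOME c. c \<in> charts_at M (\<alpha> s))"
  have "c \<in> charts_at M (\<alpha> s)"
    unfolding c_def
    by (rule someI_ex) (rule smooth_manifold_charts_at_nonempty[OF sm smooth_curve_in_topspace[OF \<alpha> s]])
  then have cA: "c \<in> rm_atlas M" and cs: "\<alpha> s \<in> fst c"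
    by (auto simp: charts_at_def)
  define J where "J = {t \<in> I. \<alpha> t \<in> fst c}"
  have J: "open J" and sJ: "s \<in> J"
    using open_curve_in_chart[OF sm \<alpha> I cA] s cs by (auto simp: J_def)
  define x where "x = snd c \<circ> \<alpha>"
  define a where "a = velocity \<alpha> s c"
  define U U' where "U = (\<lambda>t. X t c)" and "U' = vector_derivative U (at s)"
  define W W' where "W = (\<lambda>t. Y t c)" and "W' = vector_derivative W (at s)"
  let ?g = "\<lambda>j p y. rm_metric M c y $ j $ p"
  have xs: "x s \<in> snd c ` fst c"
    using cs by (auto simp: x_def)
  have "x differentiable (at s)"
    using \<alpha> cA sJ unfolding smooth_curve_def x_def J_def by (blast intro: smooth_on_differentiable)
  then have x': "(x has_vector_derivative a) (at s)"
    unfolding a_def velocity_def x_def by (simp add: vector_derivative_works)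
  have "U differentiable (at s)" "W differentiable (at s)"
    using X Y cA sJ unfolding smooth_vector_field_along_def U_def W_def J_def
    by (blast intro: smooth_on_differentiable)+
  then have "(U has_vector_derivative U') (at s)" "(W has_vector_derivative W') (at s)"
    unfolding U'_def W'_def by (simp_all add: vector_derivative_works)
  then have U: "((\<lambda>t. U t $ j) has_real_derivative U' $ j) (at s)"
    and W: "((\<lambda>t. W t $ j) has_real_derivative W' $ j) (at s)" for j
    by (auto simp: has_real_derivative_iff_has_vector_derivative
        intro: bounded_linear.has_vector_derivative[OF bounded_linear_vec_nth])
  define G' where "G' j p = (\<Sum>i\<in>UNIV. a $ i * partial_deriv i (?g j p) (x s))" for j p
  have G: "((\<lambda>t. ?g j p (x t)) has_real_derivative G' j p) (at s)" for j p
  proof -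
    let ?D = "frechet_derivative (?g j p) (at (x s))"
    have diff: "?g j p differentiable (at (x s))"
      using M cA xs by (rule metric_differentiable)
    then have "(?g j p has_derivative ?D) (at (x s))"
      by (simp add: frechet_derivative_works)
    then have "((?g j p \<circ> x) has_derivative (?D \<circ> (\<lambda>h. h *\<^sub>R a))) (at s)"
      using x' diff_chain_at unfolding has_vector_derivative_def by blast
    moreover have lin: "linear ?D"
      using diff by (rule linear_frechet_derivative)
    then have "?D \<circ> (\<lambda>h. h *\<^sub>R a) = (\<lambda>h. h *\<^sub>R ?D a)"
      by (auto simp: linear_cmul)
    moreover have "?D a = G' j p"
    proof -
      have "a = (\<Sum>i\<in>UNIV. a $ i *\<^sub>R axis i 1)"
        by (simp add: vec_eq_iff axis_def if_distrib cong: if_cong)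
      then have "?D a = (\<Sum>i\<in>UNIV. a $ i *\<^sub>R ?D (axis i 1))"
        using linear_sum[OF lin] linear_cmul[OF lin] by (metis (no_types, lifting) sum.cong)
      then show ?thesis by (simp add: G'_def partial_deriv_def)
    qed
    ultimately show ?thesis
      by (simp add: has_real_derivative_iff_has_vector_derivative has_vector_derivative_def o_def)
  qed
  let ?\<Gamma> = "\<lambda>z. (\<chi> k. \<Sum>i\<in>UNIV. \<Sum>j\<in>UNIV. christoffel M c k i j (x s) * a $ i * z $ j)"
  have "((\<lambda>t. U t \<bullet> (rm_metric M c (x t) *v W t)) has_real_derivative
      (\<Sum>j\<in>UNIV. \<Sum>p\<in>UNIV. U' $ j * (?g j p (x s) * W s $ p) +
         (G' j p * W s $ p + W' $ p * ?g j p (x s)) * U s $ j)) (at s)"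
    unfolding bilinear_coordinates by (intro DERIV_sum DERIV_mult U W G)
  moreover have "(\<Sum>j\<in>UNIV. \<Sum>p\<in>UNIV. U' $ j * (?g j p (x s) * W s $ p) +
         (G' j p * W s $ p + W' $ p * ?g j p (x s)) * U s $ j) =
      U' \<bullet> (rm_metric M c (x s) *v W s) + U s \<bullet> (rm_metric M c (x s) *v W') +
      (\<Sum>j\<in>UNIV. \<Sum>p\<in>UNIV. U s $ j * (G' j p * W s $ p))"
    unfolding bilinear_coordinates by (simp add: sum.distrib[symmetric] algebra_simps)
  moreover have "(\<Sum>j\<in>UNIV. \<Sum>p\<in>UNIV. U s $ j * (G' j p * W s $ p)) =
      ?\<Gamma> (U s) \<bullet> (rm_metric M c (x s) *v W s) + U s \<bullet> (rm_metric M c (x s) *v ?\<Gamma> (W s))"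
    unfolding G'_def by (rule christoffel_metric_compatible[OF M cA xs, symmetric])
  ultimately have "((\<lambda>t. U t \<bullet> (rm_metric M c (x t) *v W t)) has_real_derivative
      ((U' + ?\<Gamma> (U s)) \<bullet> (rm_metric M c (x s) *v W s) +
       U s \<bullet> (rm_metric M c (x s) *v (W' + ?\<Gamma> (W s))))) (at s)"
    by (simp add: inner_add_left inner_add_right matrix_vector_right_distrib algebra_simps)
  then have "((\<lambda>t. U t \<bullet> (rm_metric M c (x t) *v W t)) has_real_derivative
     (tangent_inner M (\<alpha> s) (covariant_deriv M \<alpha> X s) (Y s) +
      tangent_inner M (\<alpha> s) (X s) (covariant_deriv M \<alpha> Y s))) (at s)"
    by (simp add: tangent_inner_def c_def[symmetric] covariant_deriv_def U_def U'_def W_def W'_def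
        x_def a_def)
  then show ?thesis
  proof (rule has_field_derivative_transform_within_open[OF _ J sJ])
    fix t assume t: "t \<in> J"
    then have "tangent_vector M (\<alpha> t) (X t)" "tangent_vector M (\<alpha> t) (Y t)"
      using X Y by (auto simp: smooth_vector_field_along_def J_def)
    then show "U t \<bullet> (rm_metric M c (x t) *v W t) = tangent_inner M (\<alpha> t) (X t) (Y t)"
      using tangent_inner_chart[OF M, of c "\<alpha> t" "X t" "Y t"] t cA
      by (simp add: charts_at_def J_def U_def W_def x_def)
  qed
qed


section \<open>Parallel vector fields\<close>

text \<open>
  Fields are compared only in the charts around the points of the curve, because their values in
  other charts carry no meaning.
\<close>

lemma LC_parallel_scaleR_cong:
  fixes M :: "('p, 'n::finite) riem"
  assumes M: "smooth_manifold M" and I: "open I" and \<alpha>: "smooth_curve M I \<alpha>"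
    and X: "LC_parallel M I \<alpha> X"
    and Y: "\<And>s c. s \<in> I \<Longrightarrow> c \<in> charts_at M (\<alpha> s) \<Longrightarrow> Y s c = r *\<^sub>R X s c"
  shows "LC_parallel M I \<alpha> Y"
proof -
  have Xs: "smooth_vector_field_along M I \<alpha> X"
    using X by (simp add: LC_parallel_def)
  have Y': "Y s c = r *\<^sub>R X s c" if "c \<in> rm_atlas M" "s \<in> {s \<in> I. \<alpha> s \<in> fst c}" for s c
    using Y that by (simp add: charts_at_def)
  have "smooth_vector_field_along M I \<alpha> Y"
    unfolding smooth_vector_field_along_def
  proof (intro conjI ballI)
    fix s assume "s \<in> I"
    then have "tangent_vector M (\<alpha> s) (X s)"
      using Xs unfolding smooth_vector_field_along_def by blast
    then show "tangent_vector M (\<alpha> s) (Y s)"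
      using M Y[OF \<open>s \<in> I\<close>] by (blast intro: tangent_vector_scaleR_cong)
  next
    fix c assume c: "c \<in> rm_atlas M"
    show "smooth_on {s \<in> I. \<alpha> s \<in> fst c} (\<lambda>s. Y s c)"
    proof (rule smooth_on_scaleR_cong[OF open_curve_in_chart[OF M \<alpha> I c]])
      show "smooth_on {s \<in> I. \<alpha> s \<in> fst c} (\<lambda>s. X s c)"
        using Xs c unfolding smooth_vector_field_along_def by blast
    qed (rule Y'[OF c])
  qed
  moreover have "nabla_T M \<alpha> Y s c = 0" if s: "s \<in> I" and c: "c \<in> charts_at M (\<alpha> s)" for s c
  proof -
    have cA: "c \<in> rm_atlas M" and sJ: "s \<in> {s \<in> I. \<alpha> s \<in> fst c}"
      using s c by (auto simp: charts_at_def)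
    have "(\<lambda>t. X t c) differentiable (at s)"
      using Xs cA sJ unfolding smooth_vector_field_along_def by (blast intro: smooth_on_differentiable)
    then have "((\<lambda>t. X t c) has_vector_derivative vector_derivative (\<lambda>t. X t c) (at s)) (at s)"
      by (simp add: vector_derivative_works)
    then have "((\<lambda>t. r *\<^sub>R X t c) has_vector_derivative
        r *\<^sub>R vector_derivative (\<lambda>t. X t c) (at s)) (at s)"
      by (rule bounded_linear.has_vector_derivative[OF bounded_linear_scaleR_right])
    then have "((\<lambda>t. Y t c) has_vector_derivative
        r *\<^sub>R vector_derivative (\<lambda>t. X t c) (at s)) (at s)"
      by (rule has_vector_derivative_transform_within_open[OF _ open_curve_in_chart[OF M \<alpha> I cA] sJ])
         (simp add: Y'[OF cA])
    then have "vector_derivative (\<lambda>t. Y t c) (at s) = r *\<^sub>R vector_derivative (\<lambda>t. X t c) (at s)"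
      by (rule vector_derivative_at)
    then have "covariant_deriv M \<alpha> Y s c = r *\<^sub>R covariant_deriv M \<alpha> X s c"
      unfolding covariant_deriv_def Y[OF s c]
      by (simp add: vec_eq_iff sum_distrib_left algebra_simps)
    then have "nabla_T M \<alpha> Y s c = r *\<^sub>R nabla_T M \<alpha> X s c"
      by (simp add: nabla_T_def)
    then show ?thesis
      using X s c by (simp add: LC_parallel_def)
  qed
  ultimately show ?thesis
    by (simp add: LC_parallel_def)
qed

lemma LC_parallel_inner_has_derivative:
  assumes M: "riemannian_manifold M" and I: "open I" and \<alpha>: "smooth_curve M I \<alpha>"
    and X: "LC_parallel M I \<alpha> X" and Y: "smooth_vector_field_along M I \<alpha> Y"
    and s: "s \<in> I" and speed: "speed M \<alpha> s > 0"
  shows "((\<lambda>t. tangent_inner M (\<alpha> t) (X t) (Y t)) has_real_derivative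
     speed M \<alpha> s * tangent_inner M (\<alpha> s) (X s) (nabla_T M \<alpha> Y s)) (at s)"
proof -
  have "smooth_manifold M"
    using M by (simp add: riemannian_manifold_def)
  then have ex: "\<exists>c. c \<in> charts_at M (\<alpha> s)"
    using smooth_curve_in_topspace[OF \<alpha> s] by (rule smooth_manifold_charts_at_nonempty)
  have "nabla_T M \<alpha> X s c = 0" if "c \<in> charts_at M (\<alpha> s)" for c
    using X s that by (simp add: LC_parallel_def)
  then have "tangent_inner M (\<alpha> s) (covariant_deriv M \<alpha> X s) (Y s) =
      tangent_inner M (\<alpha> s) (\<lambda>c. 0) (Y s)"
    using speed by (intro tangent_inner_cong[OF ex]) (auto simp: nabla_T_def)
  moreover have "covariant_deriv M \<alpha> Y s = (\<lambda>c. speed M \<alpha> s *\<^sub>R nabla_T M \<alpha> Y s c)"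
    using speed by (simp add: nabla_T_def)
  moreover have "smooth_vector_field_along M I \<alpha> X"
    using X by (simp add: LC_parallel_def)
  ultimately show ?thesis
    using tangent_inner_has_derivative[OF M I \<alpha> _ Y s, of X]
    by (simp add: tangent_inner_scaleR_right)
qed


section \<open>Axes of LC helices and the Darboux vector\<close>

locale frenet_curve =
  fixes M :: "('p, 'n::finite) riem" and I :: "real set" and \<alpha> :: "real \<Rightarrow> 'p"
    and v :: "nat \<Rightarrow> real \<Rightarrow> ('p, 'n) tvec" and k :: "nat \<Rightarrow> real \<Rightarrow> real"
  assumes riemannian: "riemannian_manifold M"
    and open_domain: "open I"
    and nondegenerate: "nondegenerate_curve M I \<alpha> v k"
    and dim_ge_3: "CARD('n) \<ge> 3"
begin

abbreviation "H \<equiv> harmonic_curvature M \<alpha> k"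
abbreviation "D \<equiv> darboux M \<alpha> v k"
abbreviation "inner_at s \<equiv> tangent_inner M (\<alpha> s)"

lemma smooth_M: "smooth_manifold M"
  using riemannian by (simp add: riemannian_manifold_def)

lemma curve_smooth: "smooth_curve M I \<alpha>"
  and speed_pos: "s \<in> I \<Longrightarrow> speed M \<alpha> s > 0"
  and frame_smooth: "i \<in> {1..CARD('n)} \<Longrightarrow> smooth_vector_field_along M I \<alpha> (v i)"
  and frame_orthonormal: "s \<in> I \<Longrightarrow> i \<in> {1..CARD('n)} \<Longrightarrow> j \<in> {1..CARD('n)} \<Longrightarrow>
        inner_at s (v i s) (v j s) = (if i = j then 1 else 0)"
  and curvature_nonzero: "i \<in> {1..CARD('n) - 1} \<Longrightarrow> s \<in> I \<Longrightarrow> k i s \<noteq> 0"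
  and frame_tangent: "s \<in> I \<Longrightarrow> c \<in> charts_at M (\<alpha> s) \<Longrightarrow> v 1 s c = unit_tangent M \<alpha> s c"
  and frenet_first: "s \<in> I \<Longrightarrow> c \<in> charts_at M (\<alpha> s) \<Longrightarrow>
        nabla_T M \<alpha> (v 1) s c = k 1 s *\<^sub>R v 2 s c"
  and frenet_middle: "s \<in> I \<Longrightarrow> c \<in> charts_at M (\<alpha> s) \<Longrightarrow> 1 < i \<Longrightarrow> i < CARD('n) \<Longrightarrow>
        nabla_T M \<alpha> (v i) s c = - k (i - 1) s *\<^sub>R v (i - 1) s c + k i s *\<^sub>R v (i + 1) s c"
  using nondegenerate unfolding nondegenerate_curve_def Let_def by blast+

lemma chart_exists: "s \<in> I \<Longrightarrow> \<exists>c. c \<in> charts_at M (\<alpha> s)"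
  by (rule smooth_manifold_charts_at_nonempty[OF smooth_M smooth_curve_in_topspace[OF curve_smooth]])

lemma frame_expansion:
  assumes s: "s \<in> I" and c: "c \<in> charts_at M (\<alpha> s)" and u: "tangent_vector M (\<alpha> s) u"
  shows "u c = (\<Sum>i = 1..CARD('n). inner_at s u (v i s) *\<^sub>R v i s c)"
proof -
  let ?G = "rm_metric M c (snd c (\<alpha> s))"
  have tv: "tangent_vector M (\<alpha> s) (v i s)" if "i \<in> {1..CARD('n)}" for i
    using frame_smooth[OF that] s unfolding smooth_vector_field_along_def by blast
  note inner = tangent_inner_chart[OF riemannian c]
  have "u c = (\<Sum>i = 1..CARD('n). (u c \<bullet> (?G *v v i s c)) *\<^sub>R v i s c)"
    by (rule orthonormal_expansion) (metis inner[OF tv tv] frame_orthonormal[OF s])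
  also have "\<dots> = (\<Sum>i = 1..CARD('n). inner_at s u (v i s) *\<^sub>R v i s c)"
    by (intro sum.cong refl) (simp only: inner[OF u tv])
  finally show ?thesis .
qed

lemma parallel_coordinate_has_derivative:
  assumes "LC_parallel M I \<alpha> X" "i \<in> {1..CARD('n)}" "s \<in> I"
  shows "((\<lambda>t. inner_at t (X t) (v i t)) has_real_derivative
     speed M \<alpha> s * inner_at s (X s) (nabla_T M \<alpha> (v i) s)) (at s)"
  by (rule LC_parallel_inner_has_derivative[OF riemannian open_domain curve_smooth assms(1)
        frame_smooth[OF assms(2)] assms(3) speed_pos[OF assms(3)]])

lemma inner_frenet_first:
  assumes "s \<in> I"
  shows "inner_at s u (nabla_T M \<alpha> (v 1) s) = k 1 s * inner_at s u (v 2 s)"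
proof -
  have "inner_at s u (nabla_T M \<alpha> (v 1) s) = inner_at s u (\<lambda>c. k 1 s *\<^sub>R v 2 s c)"
    using frenet_first[OF assms] by (intro tangent_inner_cong[OF chart_exists[OF assms]]) auto
  then show ?thesis by (simp add: tangent_inner_scaleR_right)
qed

lemma inner_frenet_middle:
  assumes "s \<in> I" "1 < i" "i < CARD('n)"
  shows "inner_at s u (nabla_T M \<alpha> (v i) s) =
     - k (i - 1) s * inner_at s u (v (i - 1) s) + k i s * inner_at s u (v (i + 1) s)"
proof -
  have "inner_at s u (nabla_T M \<alpha> (v i) s) =
      inner_at s u (\<lambda>c. - k (i - 1) s *\<^sub>R v (i - 1) s c + k i s *\<^sub>R v (i + 1) s c)"
    using frenet_middle[OF assms(1) _ assms(2,3)]
    by (intro tangent_inner_cong[OF chart_exists[OF assms(1)]]) auto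
  also have "\<dots> = inner_at s u (\<lambda>c. - k (i - 1) s *\<^sub>R v (i - 1) s c) +
      inner_at s u (\<lambda>c. k i s *\<^sub>R v (i + 1) s c)"
    by (rule tangent_inner_add_right)
  finally show ?thesis
    by (simp only: tangent_inner_scaleR_right)
qed

lemma inner_unit_tangent:
  assumes "s \<in> I"
  shows "inner_at s (unit_tangent M \<alpha> s) u = inner_at s u (v 1 s)"
proof -
  have "inner_at s (v 1 s) u = inner_at s (unit_tangent M \<alpha> s) u"
    using frame_tangent[OF assms] by (intro tangent_inner_cong[OF chart_exists[OF assms]]) auto
  then show ?thesis
    using tangent_inner_commute[OF riemannian chart_exists[OF assms], of u "v 1 s"] by simp
qed

lemma arc_deriv_cong:
  assumes "s \<in> I" "\<And>t. t \<in> I \<Longrightarrow> f t = g t"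
  shows "arc_deriv M \<alpha> f s = arc_deriv M \<alpha> g s"
proof -
  have "\<forall>\<^sub>F t in nhds s. f t = g t"
    using open_domain assms eventually_nhds by blast
  then show ?thesis
    unfolding arc_deriv_def using deriv_cong_ev[of f g s s] by simp
qed

text \<open>
  Solving the Frenet system for the next coordinate. The equations for \<open>v 1\<close> and \<open>v 2\<close> give the
  two initial values, and the equation for \<open>v (j + 3)\<close> gives the recursion that defines \<open>H\<close>.
\<close>

lemma parallel_coordinates:
  assumes X: "LC_parallel M I \<alpha> X"
    and a: "\<And>s. s \<in> I \<Longrightarrow> inner_at s (X s) (v 1 s) = a"
    and "i \<le> CARD('n) - 2" "s \<in> I"
  shows "inner_at s (X s) (v (i + 2) s) = a * H i s"
  using assms(3,4)
proof (induction i arbitrary: s rule: less_induct)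
  case (less i)
  define x where "x j t = inner_at t (X t) (v j t)" for j t
  have der: "(x j has_real_derivative speed M \<alpha> t * inner_at t (X t) (nabla_T M \<alpha> (v j) t)) (at t)"
    if "j \<in> {1..CARD('n)}" "t \<in> I" for j t
    unfolding x_def by (rule parallel_coordinate_has_derivative[OF X that])
  have arc: "arc_deriv M \<alpha> (x j) t = inner_at t (X t) (nabla_T M \<alpha> (v j) t)"
    if "j \<in> {1..CARD('n)}" "t \<in> I" for j t
    using DERIV_imp_deriv[OF der[OF that]] speed_pos[OF that(2)] by (simp add: arc_deriv_def)
  have middle: "arc_deriv M \<alpha> (x j) s = - k (j - 1) s * x (j - 1) s + k j s * x (j + 1) s"
    if "1 < j" "j < CARD('n)" for j
    using arc[of j s] that less.prems(2) inner_frenet_middle[OF less.prems(2) that]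
    by (simp add: x_def)
  have const: "arc_deriv M \<alpha> f s = 0" if "\<And>t. t \<in> I \<Longrightarrow> f t = b" for f b
    using arc_deriv_cong[OF less.prems(2), of f "\<lambda>_. b"] that by (simp add: arc_deriv_def)
  consider "i = 0" | "i = 1" | j where "i = Suc (Suc j)"
    by (metis One_nat_def not0_implies_Suc)
  then have "x (i + 2) s = a * H i s"
  proof cases
    case 1
    have "arc_deriv M \<alpha> (x 1) s = 0"
      by (rule const[of _ a]) (simp only: x_def a)
    then have "k 1 s * x 2 s = 0"
      using arc[of 1 s] inner_frenet_first[OF less.prems(2)] less.prems(2) dim_ge_3
      by (simp add: x_def)
    then show ?thesis
      using 1 curvature_nonzero[of 1 s] less.prems(2) dim_ge_3 by (simp add: numeral_2_eq_2)
  next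
    case 2
    have "arc_deriv M \<alpha> (x 2) s = 0"
      using less.IH[of 0] 2 by (intro const[of _ 0]) (simp add: x_def numeral_2_eq_2)
    then have "k 1 s * a = k 2 s * x 3 s"
      using middle[of 2] dim_ge_3 a[OF less.prems(2)] by (simp add: x_def)
    then show ?thesis
      using 2 curvature_nonzero[of 2 s] less.prems(2) dim_ge_3
      by (simp add: field_simps numeral_3_eq_3)
  next
    case 3
    have j: "j + 3 < CARD('n)"
      using 3 less.prems(1) dim_ge_3 by arith
    have IH: "x (j + 3) t = a * H (Suc j) t" "x (j + 2) t = a * H j t" if "t \<in> I" for t
      using less.IH[of "Suc j" t] less.IH[of j t] that 3 less.prems(1)
      by (simp_all add: x_def numeral_3_eq_3)
    \<comment> \<open>Differentiability of \<open>H (Suc j)\<close> is inherited from the coordinate \<open>x (j + 3)\<close> when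
      \<open>a \<noteq> 0\<close>; otherwise both sides vanish.\<close>
    have "arc_deriv M \<alpha> (x (j + 3)) s = a * arc_deriv M \<alpha> (H (Suc j)) s"
    proof (cases "a = 0")
      case True
      then show ?thesis using IH(1) const[of "x (j + 3)" 0] by simp
    next
      case False
      have "arc_deriv M \<alpha> (H (Suc j)) s = arc_deriv M \<alpha> (\<lambda>t. x (j + 3) t / a) s"
        using IH(1) False by (intro arc_deriv_cong less.prems(2)) simp
      also have "\<dots> = arc_deriv M \<alpha> (x (j + 3)) s / a"
      proof -
        have "x (j + 3) field_differentiable at s"
          using der[of "j + 3" s] j less.prems(2) by (auto simp: field_differentiable_def)
        then have "deriv (\<lambda>t. x (j + 3) t / a) s = deriv (x (j + 3)) s / a"
          by (rule deriv_cdivide_right)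
        then show ?thesis by (simp add: arc_deriv_def)
      qed
      finally show ?thesis using False by simp
    qed
    then have "a * arc_deriv M \<alpha> (H (Suc j)) s =
        - k (j + 2) s * (a * H j s) + k (j + 3) s * x (j + 4) s"
      using middle[of "j + 3"] IH(2)[OF less.prems(2)] j
      by (simp add: eval_nat_numeral)
    moreover have "k (j + 3) s \<noteq> 0"
      using j less.prems(2) by (intro curvature_nonzero) auto
    ultimately have "x (j + 4) s =
        a * (1 / k (j + 3) s * (arc_deriv M \<alpha> (H (Suc j)) s + k (j + 2) s * H j s))"
      by (simp add: field_simps)
    then show ?thesis using 3 by (simp add: eval_nat_numeral)
  qed
  then show ?case by (simp add: x_def)
qed

lemma parallel_eq_darboux:
  assumes X: "LC_parallel M I \<alpha> X"
    and a: "\<And>s. s \<in> I \<Longrightarrow> inner_at s (X s) (v 1 s) = a"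
    and s: "s \<in> I" and c: "c \<in> charts_at M (\<alpha> s)"
  shows "X s c = a *\<^sub>R D s c"
proof -
  have "tangent_vector M (\<alpha> s) (X s)"
    using X s unfolding LC_parallel_def smooth_vector_field_along_def by blast
  then have "X s c = (\<Sum>i = 1..CARD('n). inner_at s (X s) (v i s) *\<^sub>R v i s c)"
    by (rule frame_expansion[OF s c])
  also have "\<dots> = a *\<^sub>R v 1 s c + (\<Sum>i = 2..CARD('n). inner_at s (X s) (v i s) *\<^sub>R v i s c)"
    using a[OF s] by (subst sum.atLeast_Suc_atMost) (auto simp: numeral_2_eq_2)
  also have "(\<Sum>i = 2..CARD('n). inner_at s (X s) (v i s) *\<^sub>R v i s c) =
      (\<Sum>i = 0..CARD('n) - 2. inner_at s (X s) (v (i + 2) s) *\<^sub>R v (i + 2) s c)"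
    by (rule sum.reindex_bij_witness[of _ "\<lambda>i. i + 2" "\<lambda>i. i - 2"])
       (use dim_ge_3 in \<open>auto simp del: add_2_eq_Suc'\<close>)
  also have "\<dots> = (\<Sum>i = 0..CARD('n) - 2. (a * H i s) *\<^sub>R v (i + 2) s c)"
    using parallel_coordinates[OF X a _ s] by (intro sum.cong refl) simp
  also have "\<dots> = (\<Sum>i = 1..CARD('n) - 2. (a * H i s) *\<^sub>R v (i + 2) s c)"
    by (subst sum.atLeast_Suc_atMost) auto
  finally show ?thesis
    by (simp add: darboux_def scaleR_add_right scaleR_sum_right)
qed

lemma inner_darboux_tangent:
  assumes "s \<in> I"
  shows "inner_at s (D s) (v 1 s) = 1"
proof -
  have "inner_at s (D s) (v 1 s) = inner_at s (v 1 s) (v 1 s) +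
      (\<Sum>i = 1..CARD('n) - 2. H i s * inner_at s (v (i + 2) s) (v 1 s))"
    unfolding darboux_def
    by (simp only: tangent_inner_add_left tangent_inner_sum_left tangent_inner_scaleR_left)
  also have "(\<Sum>i = 1..CARD('n) - 2. H i s * inner_at s (v (i + 2) s) (v 1 s)) = 0"
    using frame_orthonormal[OF assms] dim_ge_3 by (intro sum.neutral) auto
  finally show ?thesis
    using frame_orthonormal[OF assms, of 1 1] dim_ge_3 by simp
qed

text \<open>
  Expand \<open>0 \<le> \<langle>D - v\<^sub>1, D - v\<^sub>1\<rangle>\<close> with \<open>\<langle>D, v\<^sub>1\<rangle> = 1\<close>.
\<close>

lemma darboux_norm_ge_1:
  assumes "s \<in> I"
  shows "inner_at s (D s) (D s) \<ge> 1"
proof -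
  define w where "w c = D s c + (- 1) *\<^sub>R v 1 s c" for c
  note ex = chart_exists[OF assms]
  have left: "inner_at s w u = inner_at s (D s) u - inner_at s (v 1 s) u" for u
    unfolding w_def by (simp only: tangent_inner_add_left tangent_inner_scaleR_left)
  have "0 \<le> inner_at s w w"
    by (rule tangent_inner_nonneg[OF riemannian ex])
  also have "\<dots> = inner_at s w (D s) - inner_at s w (v 1 s)"
    using left[of w] tangent_inner_commute[OF riemannian ex] by metis
  also have "\<dots> = inner_at s (D s) (D s) - 1"
    using inner_darboux_tangent[OF assms] frame_orthonormal[OF assms, of 1 1] dim_ge_3
      tangent_inner_commute[OF riemannian ex, of "v 1 s" "D s"]
    by (simp add: left)
  finally show ?thesis by simp
qed

lemma LC_helix_imp_darboux_parallel:
  assumes "LC_helix M I \<alpha>"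
  shows "LC_parallel M I \<alpha> D"
proof -
  obtain X \<phi> where X: "LC_parallel M I \<alpha> X"
    and unit: "\<And>s. s \<in> I \<Longrightarrow> inner_at s (X s) (X s) = 1"
    and "\<And>s. s \<in> I \<Longrightarrow> inner_at s (unit_tangent M \<alpha> s) (X s) = cos \<phi>"
    using assms unfolding LC_helix_def by blast
  then have angle: "\<And>s. s \<in> I \<Longrightarrow> inner_at s (X s) (v 1 s) = cos \<phi>"
    by (simp add: inner_unit_tangent)
  have X_eq: "X s c = cos \<phi> *\<^sub>R D s c" if "s \<in> I" "c \<in> charts_at M (\<alpha> s)" for s c
    by (rule parallel_eq_darboux[OF X angle that])
  show ?thesis
  proof (rule LC_parallel_scaleR_cong[OF smooth_M open_domain curve_smooth X])
    fix s c assume s: "s \<in> I" and c: "c \<in> charts_at M (\<alpha> s)"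
    \<comment> \<open>Otherwise the unit field \<open>X\<close> would be zero.\<close>
    have "cos \<phi> \<noteq> 0"
    proof
      assume "cos \<phi> = 0"
      then have "inner_at s (X s) (X s) = inner_at s (\<lambda>c. 0) (\<lambda>c. 0)"
        using X_eq[OF s] by (intro tangent_inner_cong[OF chart_exists[OF s]]) auto
      then show False using unit[OF s] by simp
    qed
    then show "D s c = (1 / cos \<phi>) *\<^sub>R X s c"
      using X_eq[OF s c] by simp
  qed
qed

lemma darboux_parallel_imp_LC_helix:
  assumes D: "LC_parallel M I \<alpha> D" and "is_interval I"
  shows "LC_helix M I \<alpha>"
proof -
  have Ds: "smooth_vector_field_along M I \<alpha> D"
    using D by (simp add: LC_parallel_def)
  have norm_constant: "((\<lambda>t. inner_at t (D t) (D t)) has_real_derivative 0) (at s)" if s: "s \<in> I" for s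
  proof -
    have "inner_at s (D s) (nabla_T M \<alpha> D s) = inner_at s (D s) (\<lambda>c. 0)"
      using D s by (intro tangent_inner_cong[OF chart_exists[OF s]]) (auto simp: LC_parallel_def)
    then show ?thesis
      using LC_parallel_inner_has_derivative[OF riemannian open_domain curve_smooth D Ds s speed_pos[OF s]]
      by simp
  qed
  obtain q where q: "\<And>s. s \<in> I \<Longrightarrow> inner_at s (D s) (D s) = q" and q1: "q \<ge> 1"
  proof -
    have "convex I"
      using assms(2) by (rule is_interval_convex)
    then have "\<exists>q. \<forall>s\<in>I. inner_at s (D s) (D s) = q"
      by (rule has_field_derivative_zero_constant)
         (rule has_field_derivative_at_within[OF norm_constant])
    then obtain q where q: "\<forall>s\<in>I. inner_at s (D s) (D s) = q" ..
    \<comment> \<open>The maximum only matters for empty \<open>I\<close>, where \<open>q\<close> is arbitrary.\<close>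
    show ?thesis
      using that[of "max q 1"] q darboux_norm_ge_1 by (metis max.cobounded2 max_absorb1)
  qed
  define r where "r = 1 / sqrt q"
  have r: "0 \<le> r" "r \<le> 1" "r * (r * q) = 1"
    using q1 by (auto simp: r_def field_simps)
  define X where "X s c = r *\<^sub>R D s c" for s c
  have "LC_parallel M I \<alpha> X"
    by (rule LC_parallel_scaleR_cong[where r = r, OF smooth_M open_domain curve_smooth D]) (simp add: X_def)
  moreover have "inner_at s (X s) (X s) = 1" if "s \<in> I" for s
    using q[OF that] r(3) unfolding X_def
    by (simp only: tangent_inner_scaleR_left tangent_inner_scaleR_right)
  moreover have "inner_at s (unit_tangent M \<alpha> s) (X s) = cos (arccos r)" if "s \<in> I" for s
    using inner_darboux_tangent[OF that] r(1,2) unfolding inner_unit_tangent[OF that] X_def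
    by (simp add: tangent_inner_scaleR_left)
  ultimately show ?thesis
    unfolding LC_helix_def by blast
qed

end

theorem theorem2:
  fixes M :: "('p, 'n::finite) riem"
    and c :: real
    and F :: "'p \<Rightarrow> 'e::euclidean_space"
    and I :: "real set"
    and \<alpha> :: "real \<Rightarrow> 'p"
    and v :: "nat \<Rightarrow> real \<Rightarrow> ('p, 'n) tvec"
    and k :: "nat \<Rightarrow> real \<Rightarrow> real"
  assumes "CARD('n) \<ge> 3"
    and "space_form M c \<or> euclidean_hypersurface M F"
    and "open I" "is_interval I"
    and "nondegenerate_curve M I \<alpha> v k"
  shows "LC_helix M I \<alpha> \<longleftrightarrow> LC_parallel M I \<alpha> (darboux M \<alpha> v k)"
proof -
  have "riemannian_manifold M"
    using assms(2) by (auto simp: space_form_def euclidean_hypersurface_def)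
  then interpret frenet_curve M I \<alpha> v k
    using assms by unfold_locales
  show ?thesis
    using LC_helix_imp_darboux_parallel darboux_parallel_imp_LC_helix[OF _ assms(4)] by blast
qed

end
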